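(* Let $p=p(n)$ satisfy $np\to\infty$ and $p\to0$ as $n\to\infty$, and let $G_{n,p}$ be the binomial random graph. (1) Given $1/2<c<1$, suppose $p=o(n^{-c})$. Then asymptotically almost surely, for every proper colouring of $G_{n,p}$ there is a rainbow induced subgraph on $\chi(G_{n,p})$ vertices of chromatic number $O(\log\chi(G_{n,p}))$. (2) Given $0\le c<1$, suppose $p=\omega(n^{-c})$. Then asymptotically almost surely, for every proper colouring of $G_{n,p}$ there is a rainbow induced subgraph on $\chi(G_{n,p})$ vertices of chromatic number \[O\Big(-\log p\cdot\max\Big\{p,\sqrt{(\log n)/(np)}\Big\}\,\chi(G_{n,p})\Big).\]
   Context: $G_{n,p}$ is the random graph on $n$ vertices with each edge present independently with probability $p$. Asymptotically almost surely means with probability tending to $1$ as $n\to\infty$. $\chi$ denotes chromatic number. Given a proper colouring, a subgraph is rainbow if its vertices receive pairwise distinct colours. $O(\cdot)$ hides constants independent of $n$. *)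

theory Defs
  imports "HOL-Probability.Probability" "HOL-Library.Landau_Symbols"
begin

text \<open>A graph is a pair of a vertex set and a set of edges, each edge being the set
  of its two endpoints.\<close>

type_synonym 'v graph = "'v set \<times> 'v set set"

abbreviation verts :: "'v graph \<Rightarrow> 'v set" where
  "verts G \<equiv> fst G"

abbreviation edges :: "'v graph \<Rightarrow> 'v set set" where
  "edges G \<equiv> snd G"

definition proper_colouring :: "'v graph \<Rightarrow> ('v \<Rightarrow> 'c) \<Rightarrow> bool" where
  "proper_colouring G f \<longleftrightarrow> (\<forall>x\<in>verts G. \<forall>y\<in>verts G. {x, y} \<in> edges G \<longrightarrow> f x \<noteq> f y)"

text \<open>Meaningful for finite loopless graphs only; otherwise the set of admissible
  \<open>k\<close> may be empty.\<close>

definition chromatic_number :: "'v graph \<Rightarrow> nat" where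
  "chromatic_number G =
     (LEAST k. \<exists>f :: 'v \<Rightarrow> nat. proper_colouring G f \<and> f ` verts G \<subseteq> {..<k})"

definition induced_subgraph :: "'v graph \<Rightarrow> 'v set \<Rightarrow> 'v graph" where
  "induced_subgraph G S = (S, {e \<in> edges G. e \<subseteq> S})"

definition rainbow :: "('v \<Rightarrow> 'c) \<Rightarrow> 'v graph \<Rightarrow> bool" where
  "rainbow f H \<longleftrightarrow> inj_on f (verts H)"

definition all_pairs :: "nat \<Rightarrow> nat set set" where
  "all_pairs n = {e. e \<subseteq> {..<n} \<and> card e = 2}"

text \<open>Only meant for \<open>0 \<le> p \<le> 1\<close>: \<^const>\<open>bernoulli_pmf\<close> truncates other values
  of \<open>p\<close> to this interval.\<close>

definition random_graph :: "nat \<Rightarrow> real \<Rightarrow> nat graph pmf" where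
  "random_graph n p =
     map_pmf (\<lambda>X. ({..<n}, {e \<in> all_pairs n. X e}))
       (Pi_pmf (all_pairs n) False (\<lambda>_. bernoulli_pmf p))"

definition asymptotically_almost_surely ::
    "(nat \<Rightarrow> 'a pmf) \<Rightarrow> (nat \<Rightarrow> 'a \<Rightarrow> bool) \<Rightarrow> bool" where
  "asymptotically_almost_surely M P \<longleftrightarrow>
     (\<lambda>n. measure_pmf.prob (M n) {x. P n x}) \<longlonglongrightarrow> 1"

end

theory Submission
  imports Defs "HOL-Real_Asymp.Real_Asymp"
begin

text \<open>Any rainbow set on \<open>\<chi>(G)\<close> vertices works, and one exists because a proper colouring
  uses at least \<open>\<chi>(G)\<close> colours: with high probability all sets of that size have small
  chromatic number. By a union bound every nonempty vertex set \<open>U\<close> spans fewer than \<open>d |U|\<close>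
  edges, with \<open>d\<close> of order \<open>p |U| + ln n\<close>, so induced subgraphs on \<open>s\<close> vertices are
  degenerate and have chromatic number \<open>O(p s + ln n)\<close>. In particular
  \<open>\<chi>(G) = O(np + ln n)\<close>. For \<open>p = o(n powr -c)\<close> with \<open>c > 1/2\<close> this gives
  \<open>\<chi>(G) = O(n powr (1 - c))\<close>, and on sets of that size the union bound works with a
  constant \<open>d\<close>. For \<open>p = \<omega>(n powr -c)\<close>, the independence number is
  \<open>O(ln n / p)\<close>, so \<open>\<chi>(G)\<close> is at least of order \<open>np / ln n\<close>, which makes
  \<open>p \<chi>(G) + ln n\<close> at most of the order claimed.\<close>

section \<open>Colourings and degeneracy\<close>

lemma chromatic_number_le:
  fixes f :: "'v \<Rightarrow> nat"
  assumes "proper_colouring G f" "f ` verts G \<subseteq> {..<k}"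
  shows "chromatic_number G \<le> k"
  unfolding chromatic_number_def using assms by (intro Least_le) blast

text \<open>Renaming the used colours bijectively to an initial segment of the naturals keeps the
  colouring proper, which makes it a candidate for the \<open>LEAST\<close>.\<close>

lemma chromatic_number_le_card_image:
  assumes "proper_colouring G f" "finite (verts G)"
  shows "chromatic_number G \<le> card (f ` verts G)"
proof -
  obtain h where h: "bij_betw h (f ` verts G) {..<card (f ` verts G)}"
    using ex_bij_betw_finite_nat[of "f ` verts G"] assms(2) by (auto simp: atLeast0LessThan)
  show ?thesis
  proof (rule chromatic_number_le)
    show "proper_colouring G (h \<circ> f)"
      using assms(1) h unfolding proper_colouring_def bij_betw_def inj_on_def by auto
    show "(h \<circ> f) ` verts G \<subseteq> {..<card (f ` verts G)}"
      using h unfolding bij_betw_def by (metis image_comp order_refl)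
  qed
qed

text \<open>Without loops, an injective numbering of the finitely many vertices is proper, so the
  \<open>LEAST\<close> ranges over a nonempty set and is attained.\<close>

lemma chromatic_number_attained:
  fixes G :: "'v graph"
  assumes "finite (verts G)" "\<And>x. {x} \<notin> edges G"
  obtains f :: "'v \<Rightarrow> nat"
    where "proper_colouring G f" "f ` verts G \<subseteq> {..<chromatic_number G}"
proof -
  obtain h where h: "bij_betw h (verts G) {..<card (verts G)}"
    using ex_bij_betw_finite_nat[OF assms(1)] by (auto simp: atLeast0LessThan)
  have "proper_colouring G h"
    unfolding proper_colouring_def
    using h assms(2) by (metis bij_betw_def inj_on_def insert_absorb2)
  then have "\<exists>k. \<exists>f :: 'v \<Rightarrow> nat. proper_colouring G f \<and> f ` verts G \<subseteq> {..<k}"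
    using h unfolding bij_betw_def by blast
  then have "\<exists>f :: 'v \<Rightarrow> nat. proper_colouring G f \<and> f ` verts G \<subseteq> {..<chromatic_number G}"
    unfolding chromatic_number_def by (rule LeastI_ex)
  then show ?thesis using that by blast
qed

text \<open>Greedy colouring: remove a vertex with fewer than \<open>D\<close> neighbours in the
  current set, colour the rest by induction, and give the vertex a colour that its neighbours leave
  free.\<close>

lemma degenerate_colouring:
  assumes "finite S" "\<And>x. {x} \<notin> E"
    and "\<And>U. U \<subseteq> S \<Longrightarrow> U \<noteq> {} \<Longrightarrow> \<exists>v\<in>U. card {u \<in> U. {u, v} \<in> E} < D"
  shows "\<exists>f :: 'v \<Rightarrow> nat. f ` S \<subseteq> {..<D} \<and>
           (\<forall>x\<in>S. \<forall>y\<in>S. {x, y} \<in> E \<longrightarrow> f x \<noteq> f y)"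
  using assms(1,3)
proof (induction S rule: finite_remove_induct)
  case empty
  then show ?case by auto
next
  case (remove S)
  obtain v where v: "v \<in> S" "card {u \<in> S. {u, v} \<in> E} < D"
    using remove.prems remove.hyps by blast
  have "\<exists>f :: 'v \<Rightarrow> nat. f ` (S - {v}) \<subseteq> {..<D} \<and>
           (\<forall>x\<in>S - {v}. \<forall>y\<in>S - {v}. {x, y} \<in> E \<longrightarrow> f x \<noteq> f y)"
    using v remove.prems by (intro remove.IH) auto
  then obtain f :: "'v \<Rightarrow> nat" where f: "f ` (S - {v}) \<subseteq> {..<D}"
    "\<forall>x\<in>S - {v}. \<forall>y\<in>S - {v}. {x, y} \<in> E \<longrightarrow> f x \<noteq> f y"
    by blast
  have "card (f ` {u \<in> S. {u, v} \<in> E}) < D"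
    using v(2) card_image_le[of "{u \<in> S. {u, v} \<in> E}" f] remove.hyps by auto
  then have "\<not> {..<D} \<subseteq> f ` {u \<in> S. {u, v} \<in> E}"
    using card_mono[of "f ` {u \<in> S. {u, v} \<in> E}" "{..<D}"] remove.hyps by auto
  then obtain c where c: "c < D" "c \<notin> f ` {u \<in> S. {u, v} \<in> E}"
    by blast
  show ?case
  proof (intro exI conjI ballI impI)
    show "(f(v := c)) ` S \<subseteq> {..<D}" using f(1) c(1) by auto
    fix x y assume xy: "x \<in> S" "y \<in> S" "{x, y} \<in> E"
    then have "x \<noteq> y" using assms(2) by auto
    then show "(f(v := c)) x \<noteq> (f(v := c)) y"
      using xy f(2) c(2) by (auto simp: insert_commute)
  qed
qed

text \<open>Double counting of incidences: a neighbour \<open>u\<close> of \<open>v\<close> inside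
  \<open>U\<close> determines the edge \<open>{u, v}\<close> injectively, and each edge inside
  \<open>U\<close> has exactly two ends.\<close>

lemma handshake_le:
  assumes "finite U" "\<And>e. e \<in> E \<Longrightarrow> card e = 2"
  shows "(\<Sum>v\<in>U. card {u \<in> U. {u, v} \<in> E}) \<le> 2 * card {e \<in> E. e \<subseteq> U}"
proof -
  let ?F = "{e \<in> E. e \<subseteq> U}"
  have fin: "finite ?F"
    using assms(1) by (rule_tac finite_subset[of _ "Pow U"]) auto
  have "(\<Sum>v\<in>U. card {u \<in> U. {u, v} \<in> E}) \<le> (\<Sum>v\<in>U. card {e \<in> ?F. v \<in> e})"
  proof (rule sum_mono)
    fix v assume "v \<in> U"
    show "card {u \<in> U. {u, v} \<in> E} \<le> card {e \<in> ?F. v \<in> e}"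
      by (rule card_inj_on_le[where f = "\<lambda>u. {u, v}"])
        (use \<open>v \<in> U\<close> in \<open>auto simp: inj_on_def doubleton_eq_iff intro: finite_subset[OF _ fin]\<close>)
  qed
  also have "\<dots> = (\<Sum>e\<in>?F. 2)"
  proof (rule sum_multicount_gen)
    show "\<forall>e\<in>?F. card {v \<in> U. v \<in> e} = 2"
    proof
      fix e assume e: "e \<in> ?F"
      then have "{v \<in> U. v \<in> e} = e" by auto
      then show "card {v \<in> U. v \<in> e} = 2" using e assms(2) by auto
    qed
  qed (use assms fin in auto)
  finally show ?thesis by simp
qed

text \<open>By handshaking, sparsity makes the average degree inside every nonempty \<open>U\<close>
  smaller than \<open>2 * D\<close>, so some vertex has degree below \<open>2 * D\<close>. As this
  holds for all subsets of \<open>S\<close>, greedy colouring applies.\<close>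

lemma chromatic_number_induced_le:
  assumes "finite S" "\<And>e. e \<in> edges G \<Longrightarrow> card e = 2"
    and sparse: "\<And>U. U \<subseteq> S \<Longrightarrow> U \<noteq> {} \<Longrightarrow> card {e \<in> edges G. e \<subseteq> U} < D * card U"
  shows "chromatic_number (induced_subgraph G S) \<le> 2 * D"
proof -
  have "\<exists>f :: 'a \<Rightarrow> nat. f ` S \<subseteq> {..<2 * D} \<and>
           (\<forall>x\<in>S. \<forall>y\<in>S. {x, y} \<in> edges G \<longrightarrow> f x \<noteq> f y)"
  proof (rule degenerate_colouring)
    show "{x} \<notin> edges G" for x using assms(2)[of "{x}"] by auto
    fix U assume U: "U \<subseteq> S" "U \<noteq> {}"
    show "\<exists>v\<in>U. card {u \<in> U. {u, v} \<in> edges G} < 2 * D"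
    proof (rule ccontr)
      assume "\<not> ?thesis"
      then have "(\<Sum>v\<in>U. 2 * D) \<le> (\<Sum>v\<in>U. card {u \<in> U. {u, v} \<in> edges G})"
        by (intro sum_mono) (auto simp: not_less)
      also have "\<dots> \<le> 2 * card {e \<in> edges G. e \<subseteq> U}"
        using handshake_le[OF finite_subset[OF U(1) assms(1)] assms(2)] by blast
      also have "\<dots> < 2 * (D * card U)" using sparse[OF U] by simp
      finally show False by (simp add: ac_simps)
    qed
  qed fact
  then obtain f :: "'a \<Rightarrow> nat" where "f ` S \<subseteq> {..<2 * D}"
    "\<forall>x\<in>S. \<forall>y\<in>S. {x, y} \<in> edges G \<longrightarrow> f x \<noteq> f y"
    by blast
  then show ?thesis
    by (intro chromatic_number_le[of _ f]) (auto simp: proper_colouring_def induced_subgraph_def)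
qed

text \<open>Colour classes of an optimal colouring are independent, so none can exceed
  \<open>a\<close> vertices when every \<open>a\<close>-set contains an edge.\<close>

lemma card_le_chromatic_number_mult:
  assumes "finite (verts G)" "\<And>e. e \<in> edges G \<Longrightarrow> card e = 2"
    and ind: "\<And>A. A \<subseteq> verts G \<Longrightarrow> card A = a \<Longrightarrow> \<exists>e\<in>edges G. e \<subseteq> A"
  shows "card (verts G) \<le> chromatic_number G * a"
proof -
  have "{x} \<notin> edges G" for x using assms(2)[of "{x}"] by auto
  then obtain f :: "'a \<Rightarrow> nat" where f: "proper_colouring G f" "f ` verts G \<subseteq> {..<chromatic_number G}"
    using chromatic_number_attained assms(1) by blast
  define k where "k = chromatic_number G"
  have "verts G = (\<Union>i<k. {x \<in> verts G. f x = i})" using f(2) by (auto simp: k_def)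
  then have "card (verts G) \<le> (\<Sum>i<k. card {x \<in> verts G. f x = i})"
    by (metis card_UN_le finite_lessThan)
  also have "\<dots> \<le> (\<Sum>i<k. a)"
  proof (rule sum_mono, rule ccontr)
    \<comment> \<open>A larger class would contain a subset of size exactly \<open>a\<close>; the
      edge that \<open>ind\<close> provides in it would join two vertices of colour
      \<open>i\<close>.\<close>
    fix i assume "\<not> card {x \<in> verts G. f x = i} \<le> a"
    then obtain A where A: "A \<subseteq> {x \<in> verts G. f x = i}" "card A = a"
      by (meson nat_le_linear obtain_subset_with_card_n)
    then obtain e where e: "e \<in> edges G" "e \<subseteq> A"
      using ind[of A] by blast
    then obtain x y where "{x, y} \<in> edges G" "{x, y} \<subseteq> A"
      using assms(2) by (metis card_2_iff)
    with A(1) f(1) show False unfolding proper_colouring_def by blast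
  qed
  finally show ?thesis by (simp add: k_def)
qed

text \<open>At least \<chi>(G) colours occur, so one can pick \<chi>(G) of them and one vertex from
  each chosen class.\<close>

lemma rainbow_subset_exists:
  assumes "proper_colouring G f" "finite (verts G)"
  shows "\<exists>S\<subseteq>verts G. card S = chromatic_number G \<and> rainbow f (induced_subgraph G S)"
proof -
  obtain T where T: "T \<subseteq> f ` verts G" "card T = chromatic_number G"
    using obtain_subset_with_card_n[OF chromatic_number_le_card_image[OF assms]] by blast
  obtain S where "S \<subseteq> verts G" "inj_on f S" "T = f ` S"
    using T(1) by (metis subset_image_inj)
  then show ?thesis
    using T(2) by (auto simp: rainbow_def induced_subgraph_def card_image)
qed


section \<open>Sparsity and independence in random graphs\<close>

lemma finite_all_pairs: "finite (all_pairs n)"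
  unfolding all_pairs_def by (rule finite_subset[of _ "Pow {..<n}"]) auto

lemma set_pmf_random_graphD:
  assumes "G \<in> set_pmf (random_graph n p)"
  shows "verts G = {..<n}" "edges G \<subseteq> all_pairs n" "e \<in> edges G \<Longrightarrow> card e = 2"
  using assms by (auto simp: random_graph_def all_pairs_def)

text \<open>Common source of the probabilities that all pairs in a set are present (\<open>b\<close>
  true) or all absent (\<open>b\<close> false).\<close>

lemma prob_bernoulli_agree:
  assumes "finite A" "F \<subseteq> A" "0 \<le> p" "p \<le> 1"
  shows "measure_pmf.prob (Pi_pmf A False (\<lambda>_. bernoulli_pmf p)) {X. \<forall>e\<in>F. X e = b} =
           (if b then p else 1 - p) ^ card F"
proof -
  \<comment> \<open>Coordinates outside \<open>F\<close> are unconstrained, so the event is a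
    product set and its probability factorises.\<close>
  have eq: "{X. \<forall>e\<in>F. X e = b} = Pi A (\<lambda>e. if e \<in> F then {b} else UNIV)"
    using assms(2) by (auto simp: Pi_def split: if_splits)
  have "measure_pmf.prob (Pi_pmf A False (\<lambda>_. bernoulli_pmf p)) {X. \<forall>e\<in>F. X e = b} =
          (\<Prod>e\<in>A. if e \<in> F then pmf (bernoulli_pmf p) b else 1)"
    unfolding eq by (subst measure_Pi_pmf_Pi) (auto intro!: prod.cong simp: assms measure_pmf_single)
  also have "\<dots> = (\<Prod>e\<in>F. pmf (bernoulli_pmf p) b)"
    using assms(1,2) by (simp add: prod.If_cases Int_absorb1)
  finally show ?thesis using assms by simp
qed

lemma prob_edges_superset:
  assumes "F \<subseteq> all_pairs n" "0 \<le> p" "p \<le> 1"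
  shows "measure_pmf.prob (random_graph n p) {G. F \<subseteq> edges G} = p ^ card F"
proof -
  have "(\<lambda>X. ({..<n}, {e \<in> all_pairs n. X e})) -` {G. F \<subseteq> edges G} = {X. \<forall>e\<in>F. X e = True}"
    using assms(1) by auto
  then show ?thesis
    using prob_bernoulli_agree[OF finite_all_pairs assms, of True]
    by (simp add: random_graph_def)
qed

lemma prob_edges_disjoint:
  assumes "F \<subseteq> all_pairs n" "0 \<le> p" "p \<le> 1"
  shows "measure_pmf.prob (random_graph n p) {G. F \<inter> edges G = {}} = (1 - p) ^ card F"
proof -
  have "(\<lambda>X. ({..<n}, {e \<in> all_pairs n. X e})) -` {G. F \<inter> edges G = {}} =
          {X. \<forall>e\<in>F. X e = False}"
    using assms(1) by auto
  then show ?thesis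
    using prob_bernoulli_agree[OF finite_all_pairs assms, of False]
    by (simp add: random_graph_def)
qed

text \<open>Events are compared on the support only, where a random graph is known to have vertex
  set \<open>{..<n}\<close> and edges of size two.\<close>

lemma prob_mono_set_pmf:
  assumes "\<And>x. x \<in> set_pmf M \<Longrightarrow> x \<in> A \<Longrightarrow> x \<in> B"
  shows "measure_pmf.prob M A \<le> measure_pmf.prob M B"
  by (rule measure_pmf.finite_measure_mono_AE) (auto simp: AE_measure_pmf_iff assms)

lemma prob_not_antimono_set_pmf:
  assumes "\<And>x. x \<in> set_pmf M \<Longrightarrow> Q x \<Longrightarrow> P x"
  shows "measure_pmf.prob M {x. \<not> P x} \<le> measure_pmf.prob M {x. \<not> Q x}"
  by (rule prob_mono_set_pmf) (use assms in blast)

section \<open>Binomial coefficient estimates and union bounds over vertex subsets\<close>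

lemma power_le_exp_mult_fact: "real m ^ m \<le> exp (real m) * fact m"
proof -
  \<comment> \<open>The left side is a single term of the exponential series at \<open>m\<close>,
    all of whose terms are nonnegative.\<close>
  have "real m ^ m / fact m \<le> exp (real m)"
    using sum_le_suminf[OF summable_exp[of "real m"], of "{m}"]
    by (simp add: exp_def scaleR_conv_of_real divide_inverse mult.commute)
  then show ?thesis by (simp add: field_simps)
qed

lemma choose_le_exp_power:
  assumes "m > 0"
  shows "real (N choose m) \<le> (exp 1 * real N / real m) ^ m"
proof -
  have "real (N choose m) * real m ^ m \<le> real (N choose m) * (exp (real m) * fact m)"
    by (intro mult_left_mono power_le_exp_mult_fact) auto
  also have "\<dots> = exp (real m) * real ((N choose m) * fact m)"
    by simp
  also have "\<dots> \<le> exp (real m) * real (N ^ m)"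
    by (intro mult_left_mono) (use binomial_fact_pow[of N m] of_nat_le_iff in blast, auto)
  finally have "real (N choose m) \<le> exp (real m) * real N ^ m / real m ^ m"
    using assms by (simp add: pos_le_divide_eq)
  also have "exp (real m) = exp 1 ^ m"
    using exp_of_nat_mult[of m "1 :: real"] by simp
  finally show ?thesis by (simp add: power_divide power_mult_distrib)
qed

lemma choose_le_power: "real (n choose k) \<le> real n ^ k"
proof -
  have "(n choose k) * 1 \<le> (n choose k) * fact k"
    by (intro mult_left_mono) auto
  then have "n choose k \<le> n ^ k"
    using binomial_fact_pow[of n k] by linarith
  then show ?thesis by (metis of_nat_le_iff of_nat_power)
qed

lemma real_choose_two: "real (n choose 2) = real n * (real n - 1) / 2"
  by (induction n) (auto simp: numeral_2_eq_2 field_simps)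

text \<open>A dense \<open>U\<close> of size \<open>s\<close> contains a set of exactly
  \<open>d s * s\<close> present edges, so a union bound over such pairs of vertex and edge sets
  applies. The bound for size \<open>s\<close> is the \<open>s\<close>-th power of the quantity that
  \<open>d\<close> makes at most \<open>q\<close>, and there are at most \<open>n\<close>
  sizes.\<close>

lemma prob_dense_subset_le:
  fixes d :: "nat \<Rightarrow> nat"
  assumes p: "0 \<le> p" "p \<le> 1" and q: "q \<le> 1"
    and d: "\<And>s. 1 \<le> s \<Longrightarrow> s \<le> M \<Longrightarrow> s \<le> n \<Longrightarrow>
              0 < d s \<and> real n * (exp 1 * real s * p / (2 * real (d s))) ^ d s \<le> q"
    and M: "1 \<le> M" "M \<le> n"
  shows "measure_pmf.prob (random_graph n p)
           {G. \<exists>U\<subseteq>{..<n}. U \<noteq> {} \<and> card U \<le> M \<and>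
                 d (card U) * card U \<le> card {e \<in> edges G. e \<subseteq> U}} \<le> real n * q"
proof -
  let ?P = "measure_pmf.prob (random_graph n p)"
  \<comment> \<open>The witnesses of density at size \<open>s\<close>: a vertex set together with
    the potential edges required to be present.\<close>
  define J where "J = (\<lambda>s. SIGMA U : {U. U \<subseteq> {..<n} \<and> card U = s}.
    {F. F \<subseteq> {e. e \<subseteq> U \<and> card e = 2} \<and> card F = d s * s})"
  have finpairs: "finite {e. e \<subseteq> U \<and> card e = 2}" if "U \<subseteq> {..<n}" for U
    using that by (rule_tac finite_subset[of _ "Pow {..<n}"]) auto
  have finF: "finite {F. F \<subseteq> {e. e \<subseteq> U \<and> card e = 2} \<and> card F = k}" if "U \<subseteq> {..<n}" for U k
    by (rule finite_subset[of _ "Pow {e. e \<subseteq> U \<and> card e = 2}"]) (use finpairs[OF that] in auto)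
  have finU: "finite {U. U \<subseteq> {..<n} \<and> card U = s}" for s
    by (rule finite_subset[of _ "Pow {..<n}"]) auto
  have finJ: "finite (J s)" for s
    unfolding J_def by (intro finite_SigmaI finU finF) auto
  have cardJ: "card (J s) = (n choose s) * ((s choose 2) choose (d s * s))" for s
  proof -
    have "card (J s) = (\<Sum>U | U \<subseteq> {..<n} \<and> card U = s. (s choose 2) choose (d s * s))"
      unfolding J_def
    proof (subst card_SigmaI[OF finU])
      show "\<forall>U\<in>{U. U \<subseteq> {..<n} \<and> card U = s}.
              finite {F. F \<subseteq> {e. e \<subseteq> U \<and> card e = 2} \<and> card F = d s * s}"
        using finF by blast
      have "card {F. F \<subseteq> {e. e \<subseteq> U \<and> card e = 2} \<and> card F = d s * s} =
              (s choose 2) choose (d s * s)" if "U \<subseteq> {..<n}" "card U = s" for U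
        using n_subsets[OF finpairs[OF that(1)], of "d s * s"]
          n_subsets[OF finite_subset[OF that(1)], of 2] that by simp
      then show "(\<Sum>U | U \<subseteq> {..<n} \<and> card U = s.
            card {F. F \<subseteq> {e. e \<subseteq> U \<and> card e = 2} \<and> card F = d s * s}) =
          (\<Sum>U | U \<subseteq> {..<n} \<and> card U = s. (s choose 2) choose (d s * s))"
        by (intro sum.cong) auto
    qed
    then show ?thesis using n_subsets[of "{..<n}" s] by simp
  qed
  have summand_le: "(\<Sum>(U, F)\<in>J s. ?P {G. F \<subseteq> edges G}) \<le> q" if s: "s \<in> {1..M}" for s
  proof -
    define m where "m = d s * s"
    have ds: "d s > 0" "real n * (exp 1 * real s * p / (2 * real (d s))) ^ d s \<le> q"
      using d[of s] s M by auto
    have m: "m > 0" using ds s by (auto simp: m_def)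
    have "(\<Sum>(U, F)\<in>J s. ?P {G. F \<subseteq> edges G}) = (\<Sum>(U, F)\<in>J s. p ^ m)"
    proof (intro sum.cong refl, clarify)
      fix U F assume "(U, F) \<in> J s"
      then have "F \<subseteq> all_pairs n" "card F = m" unfolding J_def all_pairs_def m_def by auto
      then show "?P {G. F \<subseteq> edges G} = p ^ m" using prob_edges_superset p by simp
    qed
    also have "\<dots> = real (n choose s) * real ((s choose 2) choose m) * p ^ m"
      by (simp add: case_prod_beta cardJ m_def)
    also have "\<dots> \<le> real n ^ s * (exp 1 * (real s * real s / 2) / real m) ^ m * p ^ m"
    proof (rule mult_right_mono[OF mult_mono])
      show "real (n choose s) \<le> real n ^ s" by (rule choose_le_power)
      have "real (s choose 2) \<le> real s * real s / 2"
        by (simp add: real_choose_two algebra_simps)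
      then have "(exp 1 * real (s choose 2) / real m) ^ m
                   \<le> (exp 1 * (real s * real s / 2) / real m) ^ m"
        by (intro power_mono divide_right_mono mult_left_mono) auto
      then show "real ((s choose 2) choose m) \<le> (exp 1 * (real s * real s / 2) / real m) ^ m"
        using choose_le_exp_power[OF m, of "s choose 2"] by linarith
    qed (use p in auto)
    also have "\<dots> = real n ^ s * (exp 1 * (real s * real s / 2) / real m * p) ^ m"
      by (simp only: power_mult_distrib mult.assoc)
    also have "exp 1 * (real s * real s / 2) / real m * p = exp 1 * real s * p / (2 * real (d s))"
      using s by (simp add: m_def)
    \<comment> \<open>Since \<open>m = d s * s\<close>, both factors are \<open>s\<close>-th powers.
      Choosing the vertex set thus costs only one factor \<open>n\<close> against the
      \<open>d s\<close>-th power.\<close>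
    also have "real n ^ s * (exp 1 * real s * p / (2 * real (d s))) ^ m =
                 (real n * (exp 1 * real s * p / (2 * real (d s))) ^ d s) ^ s"
      by (simp only: m_def power_mult power_mult_distrib[of "real n"])
    also have "\<dots> \<le> q ^ s"
      using ds p by (intro power_mono) auto
    also have "\<dots> \<le> q"
    proof -
      have "0 \<le> q" using ds p by (intro order_trans[OF _ ds(2)]) auto
      then show ?thesis using q s power_decreasing[of 1 s q] by auto
    qed
    finally show ?thesis .
  qed
  have "?P {G. \<exists>U\<subseteq>{..<n}. U \<noteq> {} \<and> card U \<le> M \<and>
                 d (card U) * card U \<le> card {e \<in> edges G. e \<subseteq> U}}
        \<le> ?P (\<Union>s\<in>{1..M}. \<Union>(U, F)\<in>J s. {G. F \<subseteq> edges G})"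
  proof (rule prob_mono_set_pmf)
    fix G assume G: "G \<in> set_pmf (random_graph n p)"
      and "G \<in> {G. \<exists>U\<subseteq>{..<n}. U \<noteq> {} \<and> card U \<le> M \<and>
                       d (card U) * card U \<le> card {e \<in> edges G. e \<subseteq> U}}"
    then have "\<exists>U\<subseteq>{..<n}. U \<noteq> {} \<and> card U \<le> M \<and>
                 d (card U) * card U \<le> card {e \<in> edges G. e \<subseteq> U}"
      by (simp only: mem_Collect_eq)
    then obtain U where U: "U \<subseteq> {..<n}" "U \<noteq> {}" "card U \<le> M"
      and le: "d (card U) * card U \<le> card {e \<in> edges G. e \<subseteq> U}"
      by (elim exE conjE)
    obtain F where F: "F \<subseteq> {e \<in> edges G. e \<subseteq> U}" "card F = d (card U) * card U"
      by (rule obtain_subset_with_card_n[OF le])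
    have "F \<subseteq> {e. e \<subseteq> U \<and> card e = 2}"
      using F(1) set_pmf_random_graphD(3)[OF G] by blast
    then have "(U, F) \<in> J (card U)" using F U by (simp add: J_def)
    moreover have "card U \<in> {1..M}"
      using U finite_subset[OF U(1)] by (simp add: Suc_le_eq card_gt_0_iff)
    moreover have "G \<in> {G. F \<subseteq> edges G}" using F(1) by blast
    ultimately show "G \<in> (\<Union>s\<in>{1..M}. \<Union>(U, F)\<in>J s. {G. F \<subseteq> edges G})"
      by (intro UN_I[of "card U"] UN_I[of "(U, F)"]) simp_all
  qed
  also have "\<dots> \<le> (\<Sum>s=1..M. ?P (\<Union>(U, F)\<in>J s. {G. F \<subseteq> edges G}))"
    by (intro measure_UNION_le) auto
  also have "\<dots> \<le> (\<Sum>s=1..M. \<Sum>(U, F)\<in>J s. ?P {G. F \<subseteq> edges G})"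
    unfolding case_prod_beta by (intro sum_mono measure_UNION_le finJ) auto
  also have "\<dots> \<le> (\<Sum>s=1..M. q)"
    by (intro sum_mono summand_le)
  also have "\<dots> \<le> real n * q"
  proof -
    \<comment> \<open>The instance \<open>s = 1\<close> of the hypothesis shows that
      \<open>q\<close> is nonnegative, which is what replacing the number of sizes \<open>M\<close>
      by \<open>n\<close> requires.\<close>
    have "0 \<le> real n * (exp 1 * real 1 * p / (2 * real (d 1))) ^ d 1"
      using p by (intro mult_nonneg_nonneg zero_le_power divide_nonneg_nonneg) auto
    also have "\<dots> \<le> q" using d[of 1] M by auto
    finally have "0 \<le> q" .
    then show ?thesis using M by (auto intro!: mult_right_mono)
  qed
  finally show ?thesis .
qed

text \<open>Union bound over the \<open>a\<close>-sets: each is independent with probability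
  \<open>(1 - p) ^ (a choose 2)\<close>, and \<open>1 - p \<le> exp (- p)\<close>.\<close>

lemma prob_independent_subset_le:
  assumes p: "0 \<le> p" "p \<le> 1"
  shows "measure_pmf.prob (random_graph n p)
           {G. \<exists>A\<subseteq>{..<n}. card A = a \<and> (\<forall>e\<in>edges G. \<not> e \<subseteq> A)}
         \<le> real (n choose a) * exp (- p * (real a * (real a - 1) / 2))"
proof -
  let ?P = "measure_pmf.prob (random_graph n p)"
  let ?S = "{A. A \<subseteq> {..<n} \<and> card A = a}"
  let ?F = "\<lambda>A. {e. e \<subseteq> A \<and> card e = 2}"
  have "?P {G. \<exists>A\<subseteq>{..<n}. card A = a \<and> (\<forall>e\<in>edges G. \<not> e \<subseteq> A)}
          \<le> ?P (\<Union>A\<in>?S. {G. ?F A \<inter> edges G = {}})"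
    by (rule measure_pmf.finite_measure_mono) auto
  also have "\<dots> \<le> (\<Sum>A\<in>?S. ?P {G. ?F A \<inter> edges G = {}})"
    by (intro measure_UNION_le) (auto intro: finite_subset[of _ "Pow {..<n}"])
  also have "\<dots> = (\<Sum>A\<in>?S. (1 - p) ^ (a choose 2))"
  proof (rule sum.cong)
    fix A assume A: "A \<in> ?S"
    then have "card (?F A) = a choose 2"
      using n_subsets[of A 2] finite_subset[of A "{..<n}"] by auto
    moreover have "?F A \<subseteq> all_pairs n" using A by (auto simp: all_pairs_def)
    ultimately show "?P {G. ?F A \<inter> edges G = {}} = (1 - p) ^ (a choose 2)"
      using prob_edges_disjoint p by simp
  qed auto
  also have "\<dots> = real (n choose a) * (1 - p) ^ (a choose 2)"
    using n_subsets[of "{..<n}" a] by simp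
  also have "\<dots> \<le> real (n choose a) * exp (- p * real (a choose 2))"
  proof (intro mult_left_mono)
    have "(1 - p) ^ (a choose 2) \<le> exp (- p) ^ (a choose 2)"
      using p exp_ge_add_one_self[of "- p"] by (intro power_mono) auto
    then show "(1 - p) ^ (a choose 2) \<le> exp (- p * real (a choose 2))"
      by (simp add: exp_of_nat_mult[symmetric] mult.commute)
  qed auto
  finally show ?thesis by (simp add: real_choose_two)
qed


text \<open>When no dense set exists, monotonicity of \<open>d\<close> gives every nonempty subset
  of \<open>S\<close> the same density bound \<open>d (card S)\<close>, so the degeneracy bound
  applies to \<open>S\<close>.\<close>

lemma prob_chromatic_number_induced_gt_le:
  fixes d :: "nat \<Rightarrow> nat"
  assumes p: "0 \<le> p" "p \<le> 1" and q: "q \<le> 1" and "mono d"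
    and d: "\<And>s. 1 \<le> s \<Longrightarrow> s \<le> M \<Longrightarrow> s \<le> n \<Longrightarrow>
              0 < d s \<and> real n * (exp 1 * real s * p / (2 * real (d s))) ^ d s \<le> q"
    and M: "1 \<le> M" "M \<le> n"
  shows "measure_pmf.prob (random_graph n p)
           {G. \<not> (\<forall>S\<subseteq>{..<n}. card S \<le> M \<longrightarrow>
                   chromatic_number (induced_subgraph G S) \<le> 2 * d (card S))} \<le> real n * q"
proof -
  let ?dense = "\<lambda>G. \<exists>U\<subseteq>{..<n}. U \<noteq> {} \<and> card U \<le> M \<and>
                          d (card U) * card U \<le> card {e \<in> edges G. e \<subseteq> U}"
  have "measure_pmf.prob (random_graph n p)
           {G. \<not> (\<forall>S\<subseteq>{..<n}. card S \<le> M \<longrightarrow>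
                   chromatic_number (induced_subgraph G S) \<le> 2 * d (card S))}
        \<le> measure_pmf.prob (random_graph n p) {G. \<not> \<not> ?dense G}"
  proof (intro prob_not_antimono_set_pmf allI impI)
    fix G S
    assume G: "G \<in> set_pmf (random_graph n p)" and sparse: "\<not> ?dense G"
      and S: "S \<subseteq> {..<n}" "card S \<le> M"
    have fin: "finite S" using S finite_subset by blast
    show "chromatic_number (induced_subgraph G S) \<le> 2 * d (card S)"
    proof (rule chromatic_number_induced_le[OF fin])
      fix U assume U: "U \<subseteq> S" "U \<noteq> {}"
      have "card U \<le> card S" using U fin by (simp add: card_mono)
      then have "card {e \<in> edges G. e \<subseteq> U} < d (card U) * card U"
        using sparse U S by (meson le_trans not_le subset_trans)
      also have "\<dots> \<le> d (card S) * card U"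
        using monoD[OF \<open>mono d\<close> \<open>card U \<le> card S\<close>] by simp
      finally show "card {e \<in> edges G. e \<subseteq> U} < d (card S) * card U" .
    qed (use set_pmf_random_graphD(3)[OF G] in auto)
  qed
  also have "\<dots> \<le> real n * q"
    using prob_dense_subset_le[OF p q d M] by (simp only: not_not)
  finally show ?thesis .
qed

section \<open>Asymptotics\<close>

lemma asymptotically_almost_surelyI:
  assumes "\<forall>\<^sub>F n in sequentially. measure_pmf.prob (M n) {x. \<not> P n x} \<le> b n" "b \<longlonglongrightarrow> 0"
  shows "asymptotically_almost_surely M P"
  unfolding asymptotically_almost_surely_def
proof (rule tendsto_sandwich)
  have "measure_pmf.prob (M n) {x. P n x} = 1 - measure_pmf.prob (M n) {x. \<not> P n x}" for n
    using measure_pmf.prob_compl[of "{x. P n x}" "M n"]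
    by (simp add: Compl_eq_Diff_UNIV[symmetric] Collect_neg_eq)
  then show "\<forall>\<^sub>F n in sequentially. 1 - b n \<le> measure_pmf.prob (M n) {x. P n x}"
    using assms(1) by (auto elim: eventually_mono)
  show "(\<lambda>n. 1 - b n) \<longlonglongrightarrow> 1" using tendsto_diff[OF tendsto_const assms(2), of 1] by simp
qed auto

lemma asymptotically_almost_surely_conj:
  assumes "asymptotically_almost_surely M P" "asymptotically_almost_surely M Q"
  shows "asymptotically_almost_surely M (\<lambda>n x. P n x \<and> Q n x)"
proof (rule asymptotically_almost_surelyI)
  let ?b = "\<lambda>n. (1 - measure_pmf.prob (M n) {x. P n x}) + (1 - measure_pmf.prob (M n) {x. Q n x})"
  have compl: "1 - measure_pmf.prob (M n) {x. R x} = measure_pmf.prob (M n) {x. \<not> R x}" for R n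
    using measure_pmf.prob_compl[of "{x. R x}" "M n"]
    by (simp add: Compl_eq_Diff_UNIV[symmetric] Collect_neg_eq)
  have eq: "{x. \<not> (P n x \<and> Q n x)} = {x. \<not> P n x} \<union> {x. \<not> Q n x}" for n by auto
  show "\<forall>\<^sub>F n in sequentially. measure_pmf.prob (M n) {x. \<not> (P n x \<and> Q n x)} \<le> ?b n"
    unfolding compl eq by (intro always_eventually allI measure_Un_le) auto
  have "?b \<longlonglongrightarrow> (1 - 1) + (1 - 1)"
    using assms unfolding asymptotically_almost_surely_def by (intro tendsto_intros)
  then show "?b \<longlonglongrightarrow> 0" by simp
qed

text \<open>The implication is required only for large \<open>n\<close> and on the support, so
  deterministic facts about random graphs can be used to prove it.\<close>

lemma asymptotically_almost_surely_mono:
  assumes "asymptotically_almost_surely M P"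
    and "\<forall>\<^sub>F n in sequentially. \<forall>x\<in>set_pmf (M n). P n x \<longrightarrow> Q n x"
  shows "asymptotically_almost_surely M Q"
  unfolding asymptotically_almost_surely_def
proof (rule tendsto_sandwich)
  show "(\<lambda>n. measure_pmf.prob (M n) {x. P n x}) \<longlonglongrightarrow> 1"
    using assms(1) unfolding asymptotically_almost_surely_def .
  show "\<forall>\<^sub>F n in sequentially.
          measure_pmf.prob (M n) {x. P n x} \<le> measure_pmf.prob (M n) {x. Q n x}"
    using assms(2) by eventually_elim (rule prob_mono_set_pmf, auto)
qed auto

section \<open>Chromatic numbers of the random graph and its induced subgraphs with high
  probability\<close>

lemma aas_chromatic_number_induced_le:
  assumes p: "\<And>n. 0 \<le> p n \<and> p n \<le> 1"
  shows "asymptotically_almost_surely (\<lambda>n. random_graph n (p n))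
           (\<lambda>n G. \<forall>S\<subseteq>{..<n}. real (chromatic_number (induced_subgraph G S))
                                \<le> 10 * p n * real (card S) + 6 * ln (real n) + 2)"
proof (rule asymptotically_almost_surelyI)
  show "(\<lambda>n. real n * (1 / real n ^ 2)) \<longlonglongrightarrow> 0" by real_asymp
  show "\<forall>\<^sub>F n in sequentially. measure_pmf.prob (random_graph n (p n))
      {G. \<not> (\<forall>S\<subseteq>{..<n}. real (chromatic_number (induced_subgraph G S))
                             \<le> 10 * p n * real (card S) + 6 * ln (real n) + 2)}
      \<le> real n * (1 / real n ^ 2)"
    using eventually_ge_at_top[of 2]
  proof eventually_elim
    fix n :: nat assume n: "2 \<le> n"
    \<comment> \<open>The linear term makes the base of the \<open>d s\<close>-th power at most
      \<open>exp (- 1)\<close>; the logarithmic term then makes the power at most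
      \<open>1 / real n ^ 3\<close>. This leaves \<open>1 / real n ^ 2\<close> for each size and
      \<open>1 / real n\<close> in total.\<close>
    define d where "d = (\<lambda>s::nat. nat \<lceil>5 * p n * real s + 3 * ln (real n)\<rceil>)"
    have lnpos: "ln (real n) > 0" using n by simp
    have "mono d"
      unfolding d_def using p
      by (intro monoI nat_mono ceiling_mono add_mono mult_left_mono) auto
    have d_ge: "real (d s) \<ge> 5 * p n * real s + 3 * ln (real n)" for s
      unfolding d_def by linarith
    have d_le: "real (d s) \<le> 5 * p n * real s + 3 * ln (real n) + 1" for s
    proof -
      have "0 \<le> 5 * p n * real s + 3 * ln (real n)" using p lnpos by auto
      then show ?thesis unfolding d_def by linarith
    qed
    have "measure_pmf.prob (random_graph n (p n))
      {G. \<not> (\<forall>S\<subseteq>{..<n}. real (chromatic_number (induced_subgraph G S))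
                             \<le> 10 * p n * real (card S) + 6 * ln (real n) + 2)}
      \<le> measure_pmf.prob (random_graph n (p n))
           {G. \<not> (\<forall>S\<subseteq>{..<n}. card S \<le> n \<longrightarrow>
                   chromatic_number (induced_subgraph G S) \<le> 2 * d (card S))}"
    proof (intro prob_not_antimono_set_pmf allI impI)
      fix G S
      assume *: "\<forall>S\<subseteq>{..<n}. card S \<le> n \<longrightarrow>
          chromatic_number (induced_subgraph G S) \<le> 2 * d (card S)" "S \<subseteq> {..<n}"
      have "card S \<le> n" using card_mono[OF _ *(2)] by simp
      then have "real (chromatic_number (induced_subgraph G S)) \<le> real (2 * d (card S))"
        using * of_nat_le_iff by blast
      also have "\<dots> \<le> 10 * p n * real (card S) + 6 * ln (real n) + 2"
        using d_le[of "card S"] by simp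
      finally show "real (chromatic_number (induced_subgraph G S))
          \<le> 10 * p n * real (card S) + 6 * ln (real n) + 2" .
    qed
    also have "\<dots> \<le> real n * (1 / real n ^ 2)"
    proof (rule prob_chromatic_number_induced_gt_le[OF _ _ _ \<open>mono d\<close>])
      fix s :: nat
      have dpos: "0 < real (d s)"
        using d_ge[of s] lnpos p[of n] by (intro less_le_trans[OF _ d_ge]) (simp add: add_nonneg_pos)
      \<comment> \<open>With e \<le> 3 the square of e is at most 9, below the factor 10 in the
        linear part of \<open>2 * real (d s)\<close>.\<close>
      have "(exp 1 * exp 1) * (real s * p n) \<le> (3 * 3) * (real s * p n)"
        using exp_le p by (intro mult_right_mono mult_mono) auto
      also have "\<dots> \<le> 2 * real (d s)"
        using d_ge[of s] lnpos p[of n] mult_nonneg_nonneg[of "p n" "real s"]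
        by (simp add: algebra_simps)
      finally have "exp 1 * real s * p n / (2 * real (d s)) \<le> exp (- 1)"
        using dpos by (simp add: exp_minus field_simps)
      then have "(exp 1 * real s * p n / (2 * real (d s))) ^ d s \<le> exp (- 1) ^ d s"
        using p dpos by (intro power_mono) auto
      also have "\<dots> = exp (- real (d s))"
        using exp_of_nat_mult[of "d s" "- 1 :: real"] by simp
      also have "\<dots> \<le> exp (- (3 * ln (real n)))"
      proof -
        have "0 \<le> 5 * p n * real s" using p by auto
        then show ?thesis using d_ge[of s] by (simp only: exp_le_cancel_iff)
      qed
      also have "\<dots> = 1 / real n ^ 3"
        using n exp_of_nat_mult[of 3 "ln (real n)"] by (simp add: exp_minus inverse_eq_divide)
      finally have "real n * (exp 1 * real s * p n / (2 * real (d s))) ^ d s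
                      \<le> real n * (1 / real n ^ 3)"
        by (intro mult_left_mono) auto
      also have "\<dots> = 1 / real n ^ 2" using n by (simp add: power2_eq_square power3_eq_cube)
      finally show "0 < d s \<and> real n * (exp 1 * real s * p n / (2 * real (d s))) ^ d s
                      \<le> 1 / real n ^ 2"
        using dpos by simp
    qed (use p n in auto)
    finally show "measure_pmf.prob (random_graph n (p n))
      {G. \<not> (\<forall>S\<subseteq>{..<n}. real (chromatic_number (induced_subgraph G S))
                             \<le> 10 * p n * real (card S) + 6 * ln (real n) + 2)}
      \<le> real n * (1 / real n ^ 2)" .
  qed
qed

text \<open>With high probability there is no independent set of size \<open>a\<close>, which is
  about \<open>6 * ln (real n) / p n\<close>, so \<open>n\<close> vertices need at least
  \<open>n / a\<close> colours.\<close>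

lemma aas_chromatic_number_ge:
  assumes p: "\<And>n. 0 \<le> p n \<and> p n \<le> 1" and pos: "\<forall>\<^sub>F n in sequentially. 0 < p n"
  shows "asymptotically_almost_surely (\<lambda>n. random_graph n (p n))
           (\<lambda>n G. real n * p n \<le> 8 * ln (real n) * real (chromatic_number G))"
proof (rule asymptotically_almost_surelyI)
  show "(\<lambda>n. 1 / real n ^ 2) \<longlonglongrightarrow> 0" by real_asymp
  show "\<forall>\<^sub>F n in sequentially. measure_pmf.prob (random_graph n (p n))
      {G. \<not> real n * p n \<le> 8 * ln (real n) * real (chromatic_number G)} \<le> 1 / real n ^ 2"
    using pos eventually_ge_at_top[of 3]
  proof eventually_elim
    fix n :: nat assume pn: "0 < p n" and n: "3 \<le> n"
    \<comment> \<open>Adding 1 after rounding up gives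
      \<open>6 * ln (real n) \<le> p n * (real a - 1)\<close> and \<open>a \<ge> 1\<close>. As
      \<open>p n \<le> ln (real n)\<close>, the rounding raises the constant only from 6 to 8 in
      \<open>a_le\<close>.\<close>
    define a where "a = nat \<lceil>6 * ln (real n) / p n\<rceil> + 1"
    have "1 \<le> ln (real n)"
      using exp_le n by (subst ln_ge_iff) auto
    then have "p n \<le> ln (real n)" "0 \<le> 6 * ln (real n) / p n" using p[of n] pn by auto
    then have "real a \<le> 6 * ln (real n) / p n + 2"
      unfolding a_def by linarith
    then have a_le: "real a * p n \<le> 8 * ln (real n)"
      using pn \<open>p n \<le> ln (real n)\<close> by (simp add: field_simps)
    have a_ge: "6 * ln (real n) \<le> p n * (real a - 1)"
      using pn unfolding a_def by (simp add: pos_divide_le_eq[symmetric] mult.commute[of "p n"]) linarith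
    have "measure_pmf.prob (random_graph n (p n))
        {G. \<not> real n * p n \<le> 8 * ln (real n) * real (chromatic_number G)}
      \<le> measure_pmf.prob (random_graph n (p n))
        {G. \<exists>A\<subseteq>{..<n}. card A = a \<and> (\<forall>e\<in>edges G. \<not> e \<subseteq> A)}"
    proof (rule prob_mono_set_pmf, rule CollectI, rule ccontr)
      fix G assume G: "G \<in> set_pmf (random_graph n (p n))"
        and lt: "G \<in> {G. \<not> real n * p n \<le> 8 * ln (real n) * real (chromatic_number G)}"
        and no: "\<not> (\<exists>A\<subseteq>{..<n}. card A = a \<and> (\<forall>e\<in>edges G. \<not> e \<subseteq> A))"
      have "card (verts G) \<le> chromatic_number G * a"
        using no set_pmf_random_graphD[OF G] by (intro card_le_chromatic_number_mult) auto
      then have "real n \<le> real (chromatic_number G) * real a"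
        using set_pmf_random_graphD(1)[OF G] by (simp flip: of_nat_mult)
      then have "real n * p n \<le> real (chromatic_number G) * (real a * p n)"
        using pn by (simp add: mult.assoc[symmetric])
      also have "\<dots> \<le> real (chromatic_number G) * (8 * ln (real n))"
        using a_le by (intro mult_left_mono) auto
      finally show False using lt by (simp add: mult_ac)
    qed
    also have "\<dots> \<le> real (n choose a) * exp (- p n * (real a * (real a - 1) / 2))"
      using p by (intro prob_independent_subset_le) auto
    also have "\<dots> \<le> real n ^ a * exp (real a * - (3 * ln (real n)))"
    proof (intro mult_mono choose_le_power)
      have "real a * (6 * ln (real n)) \<le> real a * (p n * (real a - 1))"
        using a_ge by (intro mult_left_mono) auto
      then show "exp (- p n * (real a * (real a - 1) / 2)) \<le> exp (real a * - (3 * ln (real n)))"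
        by (simp add: algebra_simps)
    qed auto
    also have "\<dots> = (real n * exp (- (3 * ln (real n)))) ^ a"
      unfolding exp_of_nat_mult by (simp add: power_mult_distrib)
    also have "real n * exp (- (3 * ln (real n))) = 1 / real n ^ 2"
      using n exp_of_nat_mult[of 3 "ln (real n)"]
      by (simp add: exp_minus power2_eq_square power3_eq_cube field_simps)
    \<comment> \<open>Since \<open>a \<ge> 1\<close>, one factor can be kept and the others, being
      at most 1, dropped.\<close>
    also have "(1 / real n ^ 2) ^ a \<le> (1 / real n ^ 2) ^ 1"
      using n by (intro power_decreasing) (auto simp: a_def)
    finally show "measure_pmf.prob (random_graph n (p n))
        {G. \<not> real n * p n \<le> 8 * ln (real n) * real (chromatic_number G)} \<le> 1 / real n ^ 2"
      by simp
  qed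
qed

text \<open>Fewer than two colours suffice only if the whole vertex set is independent, which is
  unlikely as np tends to infinity. The bound keeps ln \<chi>(G) away from 0.\<close>

lemma aas_chromatic_number_ge_2:
  assumes p: "\<And>n. 0 \<le> p n \<and> p n \<le> 1"
    and np: "filterlim (\<lambda>n. real n * p n) at_top sequentially"
  shows "asymptotically_almost_surely (\<lambda>n. random_graph n (p n)) (\<lambda>n G. 2 \<le> chromatic_number G)"
proof (rule asymptotically_almost_surelyI)
  show "(\<lambda>n. exp (- (real n * p n / 2))) \<longlonglongrightarrow> 0"
    by (intro filterlim_compose[OF exp_at_bot] filterlim_compose[OF filterlim_uminus_at_bot_at_top]
        filterlim_at_top_mult_tendsto_pos[OF tendsto_const _ np, of "1/2", simplified])
  show "\<forall>\<^sub>F n in sequentially. measure_pmf.prob (random_graph n (p n))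
      {G. \<not> 2 \<le> chromatic_number G} \<le> exp (- (real n * p n / 2))"
    using eventually_ge_at_top[of 2]
  proof eventually_elim
    fix n :: nat assume n: "2 \<le> n"
    have "measure_pmf.prob (random_graph n (p n)) {G. \<not> 2 \<le> chromatic_number G}
      \<le> measure_pmf.prob (random_graph n (p n))
        {G. \<exists>A\<subseteq>{..<n}. card A = n \<and> (\<forall>e\<in>edges G. \<not> e \<subseteq> A)}"
    proof (rule prob_mono_set_pmf, rule CollectI, rule ccontr)
      fix G assume G: "G \<in> set_pmf (random_graph n (p n))"
        and lt: "G \<in> {G. \<not> 2 \<le> chromatic_number G}"
        and no: "\<not> (\<exists>A\<subseteq>{..<n}. card A = n \<and> (\<forall>e\<in>edges G. \<not> e \<subseteq> A))"
      have loopless: "{x} \<notin> edges G" for x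
        using set_pmf_random_graphD(3)[OF G, of "{x}"] by auto
      obtain f :: "nat \<Rightarrow> nat" where f: "proper_colouring G f" "f ` verts G \<subseteq> {..<chromatic_number G}"
        using chromatic_number_attained[of G] loopless set_pmf_random_graphD(1)[OF G] by auto
      have "card {..<n} = n" by simp
      then obtain e where e: "e \<in> edges G" "e \<subseteq> {..<n}" using no by blast
      then obtain x y where xy: "e = {x, y}" using set_pmf_random_graphD(3)[OF G] by (metis card_2_iff)
      have "x \<in> verts G" "y \<in> verts G" using e xy set_pmf_random_graphD(1)[OF G] by auto
      then have "f x \<noteq> f y" "f x < chromatic_number G" "f y < chromatic_number G"
        using f e xy unfolding proper_colouring_def by auto
      then show False using lt by auto
    qed
    also have "\<dots> \<le> real (n choose n) * exp (- p n * (real n * (real n - 1) / 2))"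
      using p by (intro prob_independent_subset_le) auto
    also have "\<dots> \<le> exp (- (real n * p n / 2))"
      using n p[of n] mult_left_mono[of 1 "real n - 1" "real n * p n"] by (simp add: algebra_simps)
    finally show "measure_pmf.prob (random_graph n (p n)) {G. \<not> 2 \<le> chromatic_number G}
      \<le> exp (- (real n * p n / 2))" .
  qed
qed

text \<open>On sets of order \<open>real n powr (1 - c)\<close>, the product of \<open>p n\<close>
  and the size is of order \<open>real n powr (1 - 2 * c)\<close>, a negative power of
  \<open>n\<close>. A large enough fixed exponent therefore beats the factor \<open>n\<close> in the
  union bound, and the density threshold can be constant.\<close>

lemma aas_small_subgraphs_bounded_chromatic_number:
  assumes p: "\<And>n. 0 \<le> p n \<and> p n \<le> 1" and c: "1 / 2 < c" "c < 1"
    and small: "\<forall>\<^sub>F n in sequentially. p n \<le> real n powr (- c)" and "1 \<le> C"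
  shows "\<exists>K. asymptotically_almost_surely (\<lambda>n. random_graph n (p n))
           (\<lambda>n G. \<forall>S\<subseteq>{..<n}. real (card S) \<le> C * real n powr (1 - c) \<longrightarrow>
                     chromatic_number (induced_subgraph G S) \<le> K)"
proof -
  obtain k :: nat where k: "3 / (2 * c - 1) \<le> real k"
    using real_arch_simple by blast
  \<comment> \<open>\<open>real K * (2 * c - 1) \<ge> 3\<close> turns the \<open>K\<close>-th power
    into at most a constant times \<open>real n powr (- 3)\<close>; the constant is
    \<open>B\<close>.\<close>
  define K where "K = k + 1"
  have K: "3 \<le> real K * (2 * c - 1)" "K > 0"
    using k c unfolding K_def by (auto simp: field_simps)
  define B where "B = (exp 1 * C / (2 * real K)) ^ K"
  have "0 \<le> B" using \<open>1 \<le> C\<close> by (simp add: B_def)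
  have "asymptotically_almost_surely (\<lambda>n. random_graph n (p n))
           (\<lambda>n G. \<forall>S\<subseteq>{..<n}. real (card S) \<le> C * real n powr (1 - c) \<longrightarrow>
                     chromatic_number (induced_subgraph G S) \<le> 2 * K)"
  proof (rule asymptotically_almost_surelyI)
    show "(\<lambda>n. real n * (B / real n ^ 2)) \<longlonglongrightarrow> 0" by real_asymp
    have "(\<lambda>n. B / real n ^ 2) \<longlonglongrightarrow> 0" by real_asymp
    then have "\<forall>\<^sub>F n in sequentially. B / real n ^ 2 < 1"
      by (rule order_tendstoD) simp
    then show "\<forall>\<^sub>F n in sequentially. measure_pmf.prob (random_graph n (p n))
      {G. \<not> (\<forall>S\<subseteq>{..<n}. real (card S) \<le> C * real n powr (1 - c) \<longrightarrow>
                chromatic_number (induced_subgraph G S) \<le> 2 * K)} \<le> real n * (B / real n ^ 2)"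
      using small eventually_ge_at_top[of 1]
    proof eventually_elim
      fix n :: nat
      assume q: "B / real n ^ 2 < 1" and pn: "p n \<le> real n powr (- c)" and n: "1 \<le> n"
      \<comment> \<open>An integer cutoff between 1 and \<open>n\<close>; rounding down loses no
        set, since cardinalities are integers.\<close>
      define M where "M = min n (nat \<lfloor>C * real n powr (1 - c)\<rfloor>)"
      have "1 * 1 \<le> C * real n powr (1 - c)"
        using c(2) n \<open>1 \<le> C\<close> by (intro mult_mono ge_one_powr_ge_zero) auto
      then have M: "1 \<le> M" "M \<le> n" "real M \<le> C * real n powr (1 - c)"
        using n unfolding M_def by (auto simp: min_def le_nat_iff) linarith
      have "measure_pmf.prob (random_graph n (p n))
        {G. \<not> (\<forall>S\<subseteq>{..<n}. real (card S) \<le> C * real n powr (1 - c) \<longrightarrow>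
                  chromatic_number (induced_subgraph G S) \<le> 2 * K)}
        \<le> measure_pmf.prob (random_graph n (p n))
          {G. \<not> (\<forall>S\<subseteq>{..<n}. card S \<le> M \<longrightarrow>
                  chromatic_number (induced_subgraph G S) \<le> 2 * (\<lambda>_. K) (card S))}"
      proof (intro prob_not_antimono_set_pmf allI impI)
        fix G S
        assume *: "\<forall>S\<subseteq>{..<n}. card S \<le> M \<longrightarrow>
            chromatic_number (induced_subgraph G S) \<le> 2 * (\<lambda>_. K) (card S)"
          and S: "S \<subseteq> {..<n}" "real (card S) \<le> C * real n powr (1 - c)"
        have "card S \<le> n" using card_mono[OF _ S(1)] by simp
        then have "card S \<le> M" using S(2) unfolding M_def by (simp add: le_nat_floor)
        then show "chromatic_number (induced_subgraph G S) \<le> 2 * K" using * S(1) by blast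
      qed
      also have "\<dots> \<le> real n * (B / real n ^ 2)"
      proof (rule prob_chromatic_number_induced_gt_le[OF _ _ _ _ _ M(1,2)])
        fix s :: nat assume s: "1 \<le> s" "s \<le> M" "s \<le> n"
        have "real s * p n \<le> (C * real n powr (1 - c)) * real n powr (- c)"
          using M(3) s p pn by (intro mult_mono) auto
        also have "\<dots> = C * real n powr (1 - 2 * c)"
          by (simp add: powr_add[symmetric])
        finally have "exp 1 * (real s * p n) / (2 * real K)
                        \<le> exp 1 * (C * real n powr (1 - 2 * c)) / (2 * real K)"
          by (intro divide_right_mono mult_left_mono) auto
        then have "(exp 1 * real s * p n / (2 * real K)) ^ K
                     \<le> (exp 1 * C / (2 * real K) * real n powr (1 - 2 * c)) ^ K"
          using p by (intro power_mono) (auto simp: mult_ac)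
        also have "\<dots> = B * real n powr (- (real K * (2 * c - 1)))"
          using n by (simp only: power_mult_distrib B_def[symmetric] powr_realpow[symmetric]
              powr_powr powr_gt_zero) (simp add: powr_power algebra_simps)
        also have "\<dots> \<le> B * real n powr (- 3)"
          using K n \<open>0 \<le> B\<close> by (intro mult_left_mono powr_mono) auto
        also have "real n powr (- 3) = 1 / real n ^ 3"
          using n by (simp add: powr_minus powr_numeral inverse_eq_divide)
        finally have "real n * (exp 1 * real s * p n / (2 * real K)) ^ K
                        \<le> real n * (B * (1 / real n ^ 3))"
          by (intro mult_left_mono) auto
        also have "\<dots> = B / real n ^ 2"
          using n by (simp add: power2_eq_square power3_eq_cube)
        finally show "0 < K \<and> real n * (exp 1 * real s * p n / (2 * real K)) ^ K \<le> B / real n ^ 2"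
          using K by simp
      qed (use p q in \<open>auto simp: mono_def\<close>)
      finally show "measure_pmf.prob (random_graph n (p n))
        {G. \<not> (\<forall>S\<subseteq>{..<n}. real (card S) \<le> C * real n powr (1 - c) \<longrightarrow>
                  chromatic_number (induced_subgraph G S) \<le> 2 * K)} \<le> real n * (B / real n ^ 2)" .
    qed
  qed
  then show ?thesis by blast
qed

section \<open>Combining the bounds in the two ranges of p\<close>

lemma induced_subgraph_verts_random_graph:
  assumes "G \<in> set_pmf (random_graph n p)"
  shows "induced_subgraph G {..<n} = G"
proof (rule prod_eqI)
  show "fst (induced_subgraph G {..<n}) = fst G"
    using set_pmf_random_graphD(1)[OF assms] by (simp add: induced_subgraph_def)
  have "e \<subseteq> {..<n}" if "e \<in> edges G" for e
    using set_pmf_random_graphD(2)[OF assms] that unfolding all_pairs_def by blast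
  then show "snd (induced_subgraph G {..<n}) = snd G"
    unfolding induced_subgraph_def snd_conv by blast
qed

theorem theorem12:
  fixes p :: "nat \<Rightarrow> real"
  assumes p_range: "\<And>n. 0 \<le> p n \<and> p n \<le> 1"
    and np_infinity: "filterlim (\<lambda>n. real n * p n) at_top sequentially"
    and p_zero: "p \<longlonglongrightarrow> 0"
  shows
    "(\<forall>c::real. 1/2 < c \<and> c < 1 \<and> p \<in> o(\<lambda>n. real n powr (- c)) \<longrightarrow>
        (\<exists>C::real. asymptotically_almost_surely (\<lambda>n. random_graph n (p n))
           (\<lambda>n G. \<forall>f :: nat \<Rightarrow> nat. proper_colouring G f \<longrightarrow>
              (\<exists>S \<subseteq> verts G. card S = chromatic_number G \<and>
                 rainbow f (induced_subgraph G S) \<and>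
                 real (chromatic_number (induced_subgraph G S))
                   \<le> C * ln (real (chromatic_number G)))))) \<and>
     (\<forall>c::real. 0 \<le> c \<and> c < 1 \<and> p \<in> \<omega>(\<lambda>n. real n powr (- c)) \<longrightarrow>
        (\<exists>C::real. asymptotically_almost_surely (\<lambda>n. random_graph n (p n))
           (\<lambda>n G. \<forall>f :: nat \<Rightarrow> nat. proper_colouring G f \<longrightarrow>
              (\<exists>S \<subseteq> verts G. card S = chromatic_number G \<and>
                 rainbow f (induced_subgraph G S) \<and>
                 real (chromatic_number (induced_subgraph G S))
                   \<le> C * (- ln (p n) * max (p n) (sqrt (ln (real n) / (real n * p n)))
                          * real (chromatic_number G))))))"
proof (intro conjI allI impI; elim conjE)
  fix c :: real assume c: "1 / 2 < c" "c < 1" and o: "p \<in> o(\<lambda>n. real n powr (- c))"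
  have small: "\<forall>\<^sub>F n in sequentially. p n \<le> real n powr (- c)"
    using landau_o.smallD[OF o, of 1] p_range by (auto elim!: eventually_mono)
  \<comment> \<open>The constant is 18 = 10 + 6 + 2: np, \<open>ln (real n)\<close> and 1 are each
    at most \<open>real n powr (1 - c)\<close> in the upper bound for \<chi>(G).\<close>
  obtain K where K: "asymptotically_almost_surely (\<lambda>n. random_graph n (p n))
           (\<lambda>n G. \<forall>S\<subseteq>{..<n}. real (card S) \<le> 18 * real n powr (1 - c) \<longrightarrow>
                     chromatic_number (induced_subgraph G S) \<le> K)"
    using aas_small_subgraphs_bounded_chromatic_number[OF p_range c small, of 18] by auto
  have lnbound: "\<forall>\<^sub>F n in sequentially. ln (real n) \<le> real n powr (1 - c)"
    using c by real_asymp
  show "\<exists>C::real. asymptotically_almost_surely (\<lambda>n. random_graph n (p n))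
          (\<lambda>n G. \<forall>f :: nat \<Rightarrow> nat. proper_colouring G f \<longrightarrow>
             (\<exists>S \<subseteq> verts G. card S = chromatic_number G \<and>
                rainbow f (induced_subgraph G S) \<and>
                real (chromatic_number (induced_subgraph G S)) \<le> C * ln (real (chromatic_number G))))"
  proof (rule exI, rule asymptotically_almost_surely_mono[OF
        asymptotically_almost_surely_conj[OF K
          asymptotically_almost_surely_conj[OF aas_chromatic_number_induced_le[OF p_range]
            aas_chromatic_number_ge_2[OF p_range np_infinity]]]])
    show "\<forall>\<^sub>F n in sequentially. \<forall>G\<in>set_pmf (random_graph n (p n)).
      (\<forall>S\<subseteq>{..<n}. real (card S) \<le> 18 * real n powr (1 - c) \<longrightarrow>
                     chromatic_number (induced_subgraph G S) \<le> K) \<and>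
      (\<forall>S\<subseteq>{..<n}. real (chromatic_number (induced_subgraph G S))
                             \<le> 10 * p n * real (card S) + 6 * ln (real n) + 2) \<and>
      2 \<le> chromatic_number G \<longrightarrow>
      (\<forall>f :: nat \<Rightarrow> nat. proper_colouring G f \<longrightarrow>
             (\<exists>S \<subseteq> verts G. card S = chromatic_number G \<and>
                rainbow f (induced_subgraph G S) \<and>
                real (chromatic_number (induced_subgraph G S))
                  \<le> (real K / ln 2) * ln (real (chromatic_number G))))"
      using small lnbound eventually_ge_at_top[of 1]
    proof eventually_elim
      case (elim n)
      show ?case
      proof (intro ballI impI allI; elim conjE)
        fix G and f :: "nat \<Rightarrow> nat"
        assume G: "G \<in> set_pmf (random_graph n (p n))" and f: "proper_colouring G f"
          and bounded: "\<forall>S\<subseteq>{..<n}. real (card S) \<le> 18 * real n powr (1 - c) \<longrightarrow>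
                     chromatic_number (induced_subgraph G S) \<le> K"
          and upper: "\<forall>S\<subseteq>{..<n}. real (chromatic_number (induced_subgraph G S))
                             \<le> 10 * p n * real (card S) + 6 * ln (real n) + 2"
          and two: "2 \<le> chromatic_number G"
        have "1 \<le> real n powr (1 - c)"
          using elim c by (intro ge_one_powr_ge_zero) auto
        moreover have "p n * real n \<le> real n powr (- c) * real n"
          using elim by (intro mult_right_mono) auto
        moreover have "real n powr (- c) * real n = real n powr (1 - c)"
          using elim powr_add[of "real n" "- c" 1] by simp
        \<comment> \<open>The bound on induced subgraphs, taken at the full vertex set, bounds
          \<chi>(G) itself.\<close>
        moreover have "real (chromatic_number G) \<le> 10 * p n * real n + 6 * ln (real n) + 2"
          using upper[rule_format, of "{..<n}"] induced_subgraph_verts_random_graph[OF G] by simp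
        ultimately have chi: "real (chromatic_number G) \<le> 18 * real n powr (1 - c)"
          using elim by linarith
        obtain S where S: "S \<subseteq> verts G" "card S = chromatic_number G" "rainbow f (induced_subgraph G S)"
          using rainbow_subset_exists[OF f] set_pmf_random_graphD(1)[OF G] by auto
        have "real (chromatic_number (induced_subgraph G S)) \<le> real K"
          using bounded S chi set_pmf_random_graphD(1)[OF G] by simp
        \<comment> \<open>A constant becomes a multiple of ln \<chi>(G) because \<chi>(G) \<ge>
          2.\<close>
        also have "\<dots> = real K / ln 2 * ln 2" by simp
        also have "\<dots> \<le> real K / ln 2 * ln (real (chromatic_number G))"
          using two by (intro mult_left_mono) auto
        finally show "\<exists>S \<subseteq> verts G. card S = chromatic_number G \<and>
                rainbow f (induced_subgraph G S) \<and>
                real (chromatic_number (induced_subgraph G S))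
                  \<le> (real K / ln 2) * ln (real (chromatic_number G))"
          using S by blast
      qed
    qed
  qed
next
  fix c :: real assume c: "0 \<le> c" "c < 1" and \<omega>: "p \<in> \<omega>(\<lambda>n. real n powr (- c))"
  have large: "\<forall>\<^sub>F n in sequentially. real n powr (- c) \<le> p n"
    using landau_omega.smallD[OF \<omega>, of 1] p_range by (auto elim!: eventually_mono)
  have pos: "\<forall>\<^sub>F n in sequentially. 0 < p n"
    using large eventually_gt_at_top[of 0]
    by eventually_elim (metis of_nat_0_less_iff powr_gt_zero less_le_trans less_irrefl)
  have lnbound: "\<forall>\<^sub>F n in sequentially. ln (real n) \<le> real n powr (1 - c)"
    using c by real_asymp
  \<comment> \<open>Needed when p exceeds \<open>real n powr (- (2 / 5))\<close>: then n times the
    square of p exceeds \<open>real n powr (1 / 5)\<close>.\<close>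
  have lnbound': "\<forall>\<^sub>F n in sequentially. 8 * ln (real n) * ln (real n) \<le> real n powr (1 / 5)"
    by real_asymp
  have tiny: "\<forall>\<^sub>F n in sequentially. p n < exp (- 1)"
    using p_zero by (rule order_tendstoD) simp
  show "\<exists>C::real. asymptotically_almost_surely (\<lambda>n. random_graph n (p n))
          (\<lambda>n G. \<forall>f :: nat \<Rightarrow> nat. proper_colouring G f \<longrightarrow>
             (\<exists>S \<subseteq> verts G. card S = chromatic_number G \<and>
                rainbow f (induced_subgraph G S) \<and>
                real (chromatic_number (induced_subgraph G S))
                  \<le> C * (- ln (p n) * max (p n) (sqrt (ln (real n) / (real n * p n)))
                         * real (chromatic_number G))))"
  proof (rule exI, rule asymptotically_almost_surely_mono[OF
        asymptotically_almost_surely_conj[OF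
          aas_chromatic_number_induced_le[OF p_range] aas_chromatic_number_ge[OF p_range pos]]])
    show "\<forall>\<^sub>F n in sequentially. \<forall>G\<in>set_pmf (random_graph n (p n)).
      (\<forall>S\<subseteq>{..<n}. real (chromatic_number (induced_subgraph G S))
                             \<le> 10 * p n * real (card S) + 6 * ln (real n) + 2) \<and>
      real n * p n \<le> 8 * ln (real n) * real (chromatic_number G) \<longrightarrow>
      (\<forall>f :: nat \<Rightarrow> nat. proper_colouring G f \<longrightarrow>
             (\<exists>S \<subseteq> verts G. card S = chromatic_number G \<and>
                rainbow f (induced_subgraph G S) \<and>
                real (chromatic_number (induced_subgraph G S))
                  \<le> 170 * (- ln (p n) * max (p n) (sqrt (ln (real n) / (real n * p n)))
                         * real (chromatic_number G))))"
      using large pos lnbound lnbound' tiny eventually_ge_at_top[of 3]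
    proof eventually_elim
      case (elim n)
      define m where "m = max (p n) (sqrt (ln (real n) / (real n * p n)))"
      have ln1: "1 \<le> ln (real n)"
        using exp_le elim by (subst ln_ge_iff) auto
      have n: "0 < real n" using elim by simp
      have "ln (p n) \<le> ln (exp (- 1))" using elim by (subst ln_le_cancel_iff) auto
      then have L1: "1 \<le> - ln (p n)" by simp
      have "real n powr (- c) * real n \<le> p n * real n"
        using elim by (intro mult_right_mono) auto
      moreover have "real n powr (- c) * real n = real n powr (1 - c)"
        using n powr_add[of "real n" "- c" 1] by simp
      ultimately have np: "ln (real n) \<le> real n * p n"
        using elim mult.commute[of "real n" "p n"] by linarith
      have pm: "p n \<le> m" by (simp add: m_def)
      show ?case
      proof (intro ballI impI allI; elim conjE)
        fix G and f :: "nat \<Rightarrow> nat"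
        assume G: "G \<in> set_pmf (random_graph n (p n))" and f: "proper_colouring G f"
          and upper: "\<forall>S\<subseteq>{..<n}. real (chromatic_number (induced_subgraph G S))
                             \<le> 10 * p n * real (card S) + 6 * ln (real n) + 2"
          and lower: "real n * p n \<le> 8 * ln (real n) * real (chromatic_number G)"
        define k where "k = real (chromatic_number G)"
        have k0: "0 \<le> k" by (simp add: k_def)
        have k: "real n * p n / (8 * ln (real n)) \<le> k"
          using lower ln1 by (simp add: k_def field_simps)
        have mk0: "0 \<le> m * k" using k0 pm elim by simp
        \<comment> \<open>The logarithmic term is absorbed in one of two ways. For small p,
          \<open>- ln (p n)\<close> is of order \<open>ln (real n)\<close> and \<open>m * k\<close>
          is bounded below; for large p, \<open>p n * k\<close> alone already exceeds
          \<open>ln (real n)\<close>.\<close>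
        have ln_le: "ln (real n) \<le> 20 * (- ln (p n) * (m * k))"
        proof (cases "p n \<le> real n powr (- (2 / 5))")
          case True
          have "ln (p n) \<le> ln (real n powr (- (2 / 5)))"
            using True elim n by (subst ln_le_cancel_iff) auto
          then have L: "2 / 5 * ln (real n) \<le> - ln (p n)" using n by (simp add: ln_powr)
          \<comment> \<open>\<open>r\<close> is the reciprocal of the square root in the maximum, so
            \<open>1 / r \<le> m\<close>. The lower bound on \<open>k\<close> is
            \<open>r * r / 8\<close>, hence \<open>m * k \<ge> r / 8 \<ge> 1 / 8\<close>.\<close>
          define r where "r = sqrt (real n * p n / ln (real n))"
          have r1: "1 \<le> r" unfolding r_def using np ln1 by simp
          have r2: "r * r = real n * p n / ln (real n)"
            unfolding r_def using elim ln1 by simp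
          have "sqrt (ln (real n) / (real n * p n)) = 1 / r"
            by (simp add: r_def real_sqrt_divide)
          then have "1 / r \<le> m" by (simp add: m_def)
          moreover have "r * r / 8 \<le> k" using k by (simp add: r2 mult.commute)
          ultimately have "1 / r * (r * r / 8) \<le> m * k"
            using r1 k0 by (intro mult_mono) (auto intro: order_trans[of 0 "1 / r"])
          then have "1 / 8 \<le> m * k" using r1 by simp
          \<comment> \<open>The product of 2/5 and 1/8 is 1/20, the source of the constant 20 in
            \<open>ln_le\<close>.\<close>
          then have "(2 / 5 * ln (real n)) * (1 / 8) \<le> - ln (p n) * (m * k)"
            using L ln1 L1 by (intro mult_mono) auto
          then show ?thesis by simp
        next
          case False
          have "8 * ln (real n) * ln (real n) \<le> real n * (real n powr (- (2 / 5)) * real n powr (- (2 / 5)))"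
          proof -
            have "real n * (real n powr (- (2 / 5)) * real n powr (- (2 / 5))) = real n powr (1 / 5)"
              using n powr_add[of "real n" 1 "- (4 / 5)"] by (simp add: powr_add[symmetric])
            then show ?thesis using elim by simp
          qed
          also have "\<dots> \<le> real n * (p n * p n)"
            using False elim by (intro mult_left_mono mult_mono) auto
          finally have "ln (real n) \<le> p n * (real n * p n / (8 * ln (real n)))"
            using ln1 by (simp add: field_simps)
          also have "\<dots> \<le> m * k"
            using pm k k0 elim by (intro mult_mono) auto
          also have "\<dots> \<le> - ln (p n) * (m * k)"
            using mult_right_mono[OF L1 mk0] by simp
          finally show ?thesis
            using L1 mk0 mult_nonneg_nonneg[of "- ln (p n)" "m * k"] by linarith
        qed
        have "p n * k \<le> 1 * (m * k)" using pm k0 by (simp add: mult_right_mono)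
        also have "\<dots> \<le> - ln (p n) * (m * k)" using L1 mk0 by (intro mult_right_mono) auto
        finally have pk_le: "p n * k \<le> - ln (p n) * (m * k)" .
        obtain S where S: "S \<subseteq> verts G" "card S = chromatic_number G" "rainbow f (induced_subgraph G S)"
          using rainbow_subset_exists[OF f] set_pmf_random_graphD(1)[OF G] by auto
        have "real (chromatic_number (induced_subgraph G S)) \<le> 10 * (p n * k) + 6 * ln (real n) + 2"
          using upper[rule_format, of S] S set_pmf_random_graphD(1)[OF G] by (simp add: k_def mult.assoc)
        \<comment> \<open>The constant is 170 = 10 + 8 * 20: the additive 2 is at most
          \<open>2 * ln (real n)\<close>, and \<open>ln_le\<close> is applied to the resulting
          \<open>8 * ln (real n)\<close>.\<close>
        also have "\<dots> \<le> 170 * (- ln (p n) * (m * k))"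
          using pk_le ln_le ln1 by linarith
        finally have "real (chromatic_number (induced_subgraph G S)) \<le>
            170 * (- ln (p n) * max (p n) (sqrt (ln (real n) / (real n * p n)))
                         * real (chromatic_number G))"
          by (simp add: m_def k_def mult.assoc)
        then show "\<exists>S \<subseteq> verts G. card S = chromatic_number G \<and>
                rainbow f (induced_subgraph G S) \<and>
                real (chromatic_number (induced_subgraph G S))
                  \<le> 170 * (- ln (p n) * max (p n) (sqrt (ln (real n) / (real n * p n)))
                         * real (chromatic_number G))"
          using S by blast
      qed
    qed
  qed
qed

end
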